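(* Let $(X,f_{1,\infty})$ be an NDS and $n\in\mathbb{N}$. Then $f_{1,\infty}$ is $\Delta$-transitive if and only if its $n$-th iterate $f_{1,\infty}^{[n]}$ is $\Delta$-transitive.
   Context: $\mathbb{N}=\{1,2,3,\dots\}$. A non-autonomous discrete dynamical system (NDS) $(X,f_{1,\infty})$ consists of a compact metric space $(X,d)$ and a sequence $f_{1,\infty}=\{f_n\}_{n=1}^\infty$ of continuous maps $f_n:X\to X$. For $i,n\in\mathbb{N}$, $f_i^n:=f_{i+(n-1)}\circ\cdots\circ f_i$, and $f_i^0=\mathrm{id}_X$. For $k\in\mathbb{N}$, the $k$-th iterate is the NDS on $X$ given by $f_{1,\infty}^{[k]}:=\{f_{k(n-1)+1}^k\}_{n=1}^\infty$ (so the composition of its first $n$ maps is $f_1^{kn}$). The NDS is $\Delta$-transitive if for any $m\in\mathbb{N}$ there exists a dense $G_\delta$ subset $Y\subset X$ such that for every $x\in Y$ the set $\{(f_1^{n}(x),f_1^{2n}(x),\dots,f_1^{mn}(x)) : n\in\mathbb{N}\}$ is dense in $X^m$. *)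

theory Defs
  imports "HOL-Analysis.Analysis"
begin

text \<open>Sequences of maps are indexed by positive integers; the value at index 0 is never used.\<close>

locale NDS = Metric_space X d
  for X :: "'a set" and d :: "'a \<Rightarrow> 'a \<Rightarrow> real" +
  fixes f :: "nat \<Rightarrow> 'a \<Rightarrow> 'a"
  assumes compact_space: "compact_space mtopology"
    and continuous: "n \<ge> 1 \<Longrightarrow> continuous_map mtopology mtopology (f n)"

text \<open>\<open>nds_comp f i n\<close> is the composition of \<open>f i\<close>, ..., \<open>f (i + (n - 1))\<close>, applied in this order.\<close>

primrec nds_comp :: "(nat \<Rightarrow> 'a \<Rightarrow> 'a) \<Rightarrow> nat \<Rightarrow> nat \<Rightarrow> 'a \<Rightarrow> 'a" where
  "nds_comp f i 0 = id"
| "nds_comp f i (Suc n) = f (i + n) \<circ> nds_comp f i n"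

definition nds_iterate :: "(nat \<Rightarrow> 'a \<Rightarrow> 'a) \<Rightarrow> nat \<Rightarrow> nat \<Rightarrow> 'a \<Rightarrow> 'a" where
  "nds_iterate f k = (\<lambda>n. nds_comp f (k * (n - 1) + 1) k)"

definition dense_in :: "'a topology \<Rightarrow> 'a set \<Rightarrow> bool" where
  "dense_in T S \<longleftrightarrow> S \<subseteq> topspace T \<and> T closure_of S = topspace T"

text \<open>The power of the space with exponent \<open>m\<close> is the product topology over the index set
  \<open>{1..m}\<close>, whose points are the extensional functions from \<open>{1..m}\<close> to \<open>X\<close>.\<close>

definition Delta_transitive ::
  "'a set \<Rightarrow> ('a \<Rightarrow> 'a \<Rightarrow> real) \<Rightarrow> (nat \<Rightarrow> 'a \<Rightarrow> 'a) \<Rightarrow> bool" where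
  "Delta_transitive X d f \<longleftrightarrow>
    (\<forall>m\<ge>1. \<exists>Y. gdelta_in (Metric_space.mtopology X d) Y \<and>
       dense_in (Metric_space.mtopology X d) Y \<and>
       (\<forall>x\<in>Y. dense_in (product_topology (\<lambda>_. Metric_space.mtopology X d) {1..m})
                {(\<lambda>j\<in>{1..m}. nds_comp f 1 (j * n) x) | n. n \<ge> 1}))"

lemma (in NDS) continuous_map_nds_comp:
  assumes "i \<ge> 1"
  shows "continuous_map mtopology mtopology (nds_comp f i n)"
proof (induction n)
  case 0
  show ?case by (simp add: id_def)
next
  case (Suc n)
  have "continuous_map mtopology mtopology (f (i + n))"
    using assms by (intro continuous) simp
  with Suc show ?case
    unfolding nds_comp.simps by (rule continuous_map_compose)
qed

lemma (in NDS) NDS_nds_iterate: "NDS X d (nds_iterate f k)"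
proof
  show "compact_space mtopology" by (rule compact_space)
  show "continuous_map mtopology mtopology (nds_iterate f k n)" if "n \<ge> 1" for n
    unfolding nds_iterate_def by (rule continuous_map_nds_comp) simp
qed

end

theory Submission imports Defs begin

text \<open>The first \<open>k\<close> maps of the \<open>n\<close>-th iterate compose to the first
  \<open>n * k\<close> maps of \<open>f\<close>, so its \<open>m\<close>-tuple at time
  \<open>k\<close> is (f_1^{nk}(x), ..., f_1^{mnk}(x)). This can be read in two ways. It consists of
  the coordinates n, 2n, ..., mn of the \<open>n * m\<close>-tuple of \<open>f\<close> at time
  \<open>k\<close>, and selecting coordinates is a continuous surjection X^{nm} -> X^m, which
  preserves density (\<open>product_topology_reindex\<close>,
  \<open>dense_in_continuous_image\<close>). It is also the \<open>m\<close>-tuple of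
  \<open>f\<close> at time \<open>n * k\<close>, so density for the iterate passes to the larger set
  of tuples of \<open>f\<close>. In both directions the set \<open>Y\<close> is kept.\<close>

lemma nds_comp_add: "nds_comp f i (m + n) = nds_comp f (i + m) n \<circ> nds_comp f i m"
  by (induction n) (simp_all add: o_assoc add.assoc)

text \<open>The iterate cuts the sequence into consecutive blocks of length \<open>k\<close>: its
  map number \<open>n + 1\<close> begins at index \<open>k * n + 1\<close>, just after the first
  \<open>n\<close> blocks.\<close>

lemma nds_comp_nds_iterate: "nds_comp (nds_iterate f k) 1 n = nds_comp f 1 (k * n)"
proof (induction n)
  case (Suc n)
  have "nds_comp f 1 (k * n + k) = nds_comp f (1 + k * n) k \<circ> nds_comp f 1 (k * n)"
    by (rule nds_comp_add)
  with Suc show ?case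
    by (simp add: nds_iterate_def add.commute)
qed simp

lemma dense_in_mono:
  assumes "dense_in T S" "S \<subseteq> S'" "S' \<subseteq> topspace T"
  shows "dense_in T S'"
  using assms closure_of_mono[of S S' T] closure_of_subset_topspace[of T S']
  unfolding dense_in_def by auto

text \<open>Continuity sends the closure of \<open>S\<close> into the closure of its image, and
  surjectivity makes that all of \<open>U\<close>.\<close>

lemma dense_in_continuous_image:
  assumes "continuous_map T U g" "g ` topspace T = topspace U" "dense_in T S"
  shows "dense_in U (g ` S)"
proof -
  have "topspace U \<subseteq> U closure_of (g ` S)"
    using continuous_map_image_closure_subset[OF assms(1), of S] assms(2,3)
    by (simp add: dense_in_def)
  then show ?thesis
    using assms(2,3) closure_of_subset_topspace[of U "g ` S"]
    unfolding dense_in_def by auto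
qed

text \<open>Used to project a power of the space onto selected coordinates. Injectivity of
  \<open>h\<close> allows the selected coordinates to be prescribed independently.\<close>

lemma product_topology_reindex:
  assumes "inj_on h J" "h ` J \<subseteq> I" "J \<noteq> {}"
  defines "g \<equiv> \<lambda>p. \<lambda>j\<in>J. p (h j)"
  shows "continuous_map (product_topology (\<lambda>_. T) I) (product_topology (\<lambda>_. T) J) g"
    and "g ` topspace (product_topology (\<lambda>_. T) I) = topspace (product_topology (\<lambda>_. T) J)"
proof -
  have "continuous_map (product_topology (\<lambda>_. T) I) T (\<lambda>p. p (h j))" if "j \<in> J" for j
    using continuous_map_product_projection[of "h j" I "\<lambda>_. T"] that assms(2) by auto
  then show cont: "continuous_map (product_topology (\<lambda>_. T) I) (product_topology (\<lambda>_. T) J) g"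
    unfolding g_def continuous_map_componentwise by auto
  show "g ` topspace (product_topology (\<lambda>_. T) I) = topspace (product_topology (\<lambda>_. T) J)"
  proof
    show "g ` topspace (product_topology (\<lambda>_. T) I) \<subseteq> topspace (product_topology (\<lambda>_. T) J)"
      using cont by (rule continuous_map_image_subset_topspace)
    show "topspace (product_topology (\<lambda>_. T) J) \<subseteq> g ` topspace (product_topology (\<lambda>_. T) I)"
    proof
      fix q assume "q \<in> topspace (product_topology (\<lambda>_. T) J)"
      then have q: "q \<in> J \<rightarrow>\<^sub>E topspace T" by simp
      obtain j0 where "j0 \<in> J" using assms(3) by blast
      define p where "p = (\<lambda>i\<in>I. if i \<in> h ` J then q (inv_into J h i) else q j0)"
      have "p \<in> I \<rightarrow>\<^sub>E topspace T"
        unfolding p_def using q \<open>j0 \<in> J\<close> by (auto simp: PiE_iff inv_into_into)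
      moreover have "g p = q"
        unfolding g_def p_def
        using q assms(1,2) by (intro ext) (auto simp: PiE_iff extensional_def)
      ultimately show "q \<in> g ` topspace (product_topology (\<lambda>_. T) I)"
        by (force simp: image_iff)
    qed
  qed
qed

theorem theorem5:
  fixes X :: "'a set" and d :: "'a \<Rightarrow> 'a \<Rightarrow> real"
    and f :: "nat \<Rightarrow> 'a \<Rightarrow> 'a" and n :: nat
  assumes "NDS X d f" and "n \<ge> 1"
  shows "Delta_transitive X d f \<longleftrightarrow> Delta_transitive X d (nds_iterate f n)"
proof -
  interpret NDS X d f by (rule assms(1))
  let ?P = "\<lambda>m. product_topology (\<lambda>_. mtopology) {1..m}"
  let ?orb = "\<lambda>m x k. \<lambda>j\<in>{1..m}. nds_comp f 1 (j * k) x"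
  let ?A = "\<lambda>m x. {?orb m x k |k. k \<ge> 1}"
  let ?B = "\<lambda>m x. {(\<lambda>j\<in>{1..m}. nds_comp (nds_iterate f n) 1 (j * k) x) |k. k \<ge> 1}"
  have from_f: "dense_in (?P m) (?B m x)"
    if "m \<ge> 1" "dense_in (?P (n * m)) (?A (n * m) x)" for m x
  proof -
    \<comment> \<open>Selects the coordinates n, 2n, ..., mn.\<close>
    let ?g = "\<lambda>p. \<lambda>j\<in>{1..m}. p (n * j)"
    have h: "inj_on ((*) n) {1..m}" "(*) n ` {1..m} \<subseteq> {1..n * m}" "{1..m} \<noteq> {}"
      using assms(2) that(1) by (auto simp: inj_on_def)
    have "?g (?orb (n * m) x k) = (\<lambda>j\<in>{1..m}. nds_comp (nds_iterate f n) 1 (j * k) x)" for k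
      using h(2) unfolding nds_comp_nds_iterate
      by (intro restrict_ext) (auto simp: mult.assoc)
    then have "?g ` ?A (n * m) x = ?B m x"
      by (simp only: setcompr_eq_image image_image)
    then show ?thesis
      using dense_in_continuous_image[OF product_topology_reindex[OF h] that(2)] by simp
  qed
  have to_f: "dense_in (?P m) (?A m x)"
    if "x \<in> X" "dense_in (?P m) (?B m x)" for m x
  proof (rule dense_in_mono[OF that(2)])
    \<comment> \<open>Time \<open>k\<close> for the iterate is time \<open>n * k\<close> for
      \<open>f\<close>, again positive as \<open>n \<ge> 1\<close>.\<close>
    have "(\<lambda>j\<in>{1..m}. nds_comp (nds_iterate f n) 1 (j * k) x) = ?orb m x (n * k)" for k
      unfolding nds_comp_nds_iterate by (simp add: mult.left_commute)
    then show "?B m x \<subseteq> ?A m x"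
      using assms(2) by fastforce
    have "nds_comp f 1 k x \<in> X" for k
      using continuous_map_image_subset_topspace[OF continuous_map_nds_comp[of 1 k]] that(1)
      by auto
    then show "?A m x \<subseteq> topspace (?P m)" by auto
  qed
  show ?thesis
  proof
    assume L: "Delta_transitive X d f"
    show "Delta_transitive X d (nds_iterate f n)"
      unfolding Delta_transitive_def
    proof (intro allI impI)
      fix m :: nat assume m: "m \<ge> 1"
      \<comment> \<open>Transitivity of \<open>f\<close> is applied with exponent
        \<open>n * m\<close>, leaving room for the coordinate \<open>n * m\<close>.\<close>
      with assms(2) have "n * m \<ge> 1" by simp
      with L obtain Y where "gdelta_in mtopology Y" "dense_in mtopology Y"
        "\<forall>x\<in>Y. dense_in (?P (n * m)) (?A (n * m) x)"
        unfolding Delta_transitive_def by blast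
      with from_f[OF m] show "\<exists>Y. gdelta_in mtopology Y \<and> dense_in mtopology Y \<and>
          (\<forall>x\<in>Y. dense_in (?P m) (?B m x))"
        by blast
    qed
  next
    assume R: "Delta_transitive X d (nds_iterate f n)"
    show "Delta_transitive X d f"
      unfolding Delta_transitive_def
    proof (intro allI impI)
      fix m :: nat assume "m \<ge> 1"
      with R obtain Y where Y: "gdelta_in mtopology Y" "dense_in mtopology Y"
        "\<forall>x\<in>Y. dense_in (?P m) (?B m x)"
        unfolding Delta_transitive_def by blast
      then have "Y \<subseteq> X" by (simp add: dense_in_def)
      with Y to_f show "\<exists>Y. gdelta_in mtopology Y \<and> dense_in mtopology Y \<and>
          (\<forall>x\<in>Y. dense_in (?P m) (?A m x))"
        by blast
    qed
  qed
qed

end
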